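(* Let $p>0$, $\nu\ge0$, and let $\alpha>0$, $\beta>0$ satisfy $2\alpha-\beta\ge0$. Put $\chi:=2\beta/(2\alpha+\beta)$, so that $0<\chi\le1$. Let $\kappa,\mu\in\mathbb{C}$ with $2\mu\notin\{-1,-2,\ldots\}$, $\mu\pm\kappa+\frac12\notin\{0,-1,-2,\ldots\}$ and $\Re(\mu+\alpha+\frac12)>0$. Then $$\int_0^\infty x^{\alpha-1}e^{-\alpha x}M_{\kappa,\mu}^{(p,\nu)}(\beta x)\,dx=\beta^{-\alpha}\,\Gamma(\mu+\alpha+\tfrac12)\,\chi^{\mu+\alpha+\frac12}\,F_{p,\nu}\left(\mu+\alpha+\tfrac12,\,\mu-\kappa+\tfrac12;\,2\mu+1;\,\chi\right).$$
   Context: $B(x,y)=\Gamma(x)\Gamma(y)/\Gamma(x+y)$ is the Beta function ($x,y\ne 0,-1,-2,\ldots$), $K_\lambda$ is the modified Bessel function of the second kind, and $(a)_n=\Gamma(a+n)/\Gamma(a)$. For $\Re(p)>0$, $\nu\ge 0$, the extended Beta function is $$B_{p,\nu}(x,y)=\sqrt{\frac{2p}{\pi}}\int_0^1 t^{x-\frac32}(1-t)^{y-\frac32}K_{\nu+\frac12}\left(\frac{p}{t(1-t)}\right)dt.$$ The $(p,\nu)$-extended confluent hypergeometric function is $$\Phi_{p,\nu}(b;c;z)=\sum_{m=0}^\infty\frac{B_{p,\nu}(b+m,c-b)}{B(b,c-b)}\frac{z^m}{m!}=\frac{1}{B(b,c-b)}\sqrt{\frac{2p}{\pi}}\int_0^1t^{b-\frac32}(1-t)^{c-b-\frac32}e^{zt}K_{\nu+\frac12}\left(\frac{p}{t(1-t)}\right)dt.$$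 The $(p,\nu)$-extended Whittaker function is $$M_{\kappa,\mu}^{(p,\nu)}(z)=z^{\mu+\frac12}e^{-z/2}\,\Phi_{p,\nu}(\mu-\kappa+\tfrac12;2\mu+1;z),$$ with principal powers of $z$. The $(p,\nu)$-extended Gauss hypergeometric function is $F_{p,\nu}(a,b;c;z)=\sum_{n=0}^\infty\frac{(a)_nB_{p,\nu}(b+n,c-b)}{B(b,c-b)}\frac{z^n}{n!}$ for $|z|<1$, and more generally, for $|\arg(1-z)|<\pi$, $\Re(p)>0$, $$F_{p,\nu}(a,b;c;z)=\frac{1}{B(b,c-b)}\sqrt{\frac{2p}{\pi}}\int_0^1t^{b-\frac32}(1-t)^{c-b-\frac32}(1-zt)^{-a}K_{\nu+\frac12}\left(\frac{p}{t(1-t)}\right)dt;$$ at $z=1$ it is given by the same (convergent) integral. *)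

theory Defs
  imports "HOL-Analysis.Analysis"
begin

(* Modified Bessel function of the second kind (Macdonald function) K_lam(z), by its
   standard integral; meaningful for Re z > 0 only, where it converges for every order. *)
definition bessel_K :: "complex \<Rightarrow> complex \<Rightarrow> complex" where
  "bessel_K lam z =
     (LINT u:{0<..}|lborel. exp (- z * of_real (cosh u)) * cosh (lam * of_real u))"

(* In the definitions below p is a complex number with Re p > 0 and nu \<ge> 0; all complex
   powers and the square root are principal. *)

definition ext_Beta :: "complex \<Rightarrow> real \<Rightarrow> complex \<Rightarrow> complex \<Rightarrow> complex" where
  "ext_Beta p nu x y = csqrt (2 * p / of_real pi) *
     (LINT t:{0<..<1}|lborel.
        of_real t powr (x - 3/2) * of_real (1 - t) powr (y - 3/2) *
        bessel_K (of_real (nu + 1/2)) (p / of_real (t * (1 - t))))"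

definition ext_Phi :: "complex \<Rightarrow> real \<Rightarrow> complex \<Rightarrow> complex \<Rightarrow> complex \<Rightarrow> complex" where
  "ext_Phi p nu b c z =
     (\<Sum>m. ext_Beta p nu (b + of_nat m) (c - b) / Beta b (c - b) * (z ^ m / fact m))"

definition ext_Whittaker_M ::
    "complex \<Rightarrow> real \<Rightarrow> complex \<Rightarrow> complex \<Rightarrow> complex \<Rightarrow> complex" where
  "ext_Whittaker_M p nu \<kappa> \<mu> z =
     z powr (\<mu> + 1/2) * exp (- z / 2) * ext_Phi p nu (\<mu> - \<kappa> + 1/2) (2 * \<mu> + 1) z"

(* Power series inside the unit disc; elsewhere (|arg (1 - z)| < pi, or z = 1) the integral
   that continues it. *)
definition ext_F ::
    "complex \<Rightarrow> real \<Rightarrow> complex \<Rightarrow> complex \<Rightarrow> complex \<Rightarrow> complex \<Rightarrow> complex" where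
  "ext_F p nu a b c z =
     (if norm z < 1 then
        (\<Sum>n. pochhammer a n * ext_Beta p nu (b + of_nat n) (c - b) / Beta b (c - b) *
              (z ^ n / fact n))
      else
        1 / Beta b (c - b) * csqrt (2 * p / of_real pi) *
        (LINT t:{0<..<1}|lborel.
           of_real t powr (b - 3/2) * of_real (1 - t) powr (c - b - 3/2) *
           (1 - z * of_real t) powr (- a) *
           bessel_K (of_real (nu + 1/2)) (p / of_real (t * (1 - t)))))"

end

theory Submission
  imports Defs
begin

text \<open>
  Write \<open>s = \<mu> + \<alpha> + 1/2\<close>. Summing the series for \<open>\<Phi>\<close> under the integral sign turns the left-hand
  side into a double integral over \<open>0 < t < 1\<close> and \<open>x > 0\<close> whose dependence on \<open>x\<close> is
  \<open>x\<^sup>s\<^sup>-\<^sup>1 exp (- (\<beta>/\<chi>) (1 - \<chi> t) x)\<close>. Integrating over \<open>x\<close> first gives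
  \<open>\<Gamma>(s) (\<beta>/\<chi>)\<^sup>-\<^sup>s (1 - \<chi> t)\<^sup>-\<^sup>s\<close>, and the remaining integral over \<open>t\<close> is the Euler integral of
  \<open>F\<close>, which for \<open>\<chi> < 1\<close> is the sum of its series by the binomial theorem.
  Fubini's theorem applies, even for \<open>\<chi> = 1\<close>, because \<open>\<bar>K(y)\<bar> \<le> exp (q - y) K(q)\<close> for \<open>y \<ge> q > 0\<close>
  (as \<open>cosh u \<ge> 1\<close>): at \<open>y = p / (t (1 - t)) = p/t + p/(1 - t)\<close> this decay absorbs every power of
  \<open>t\<close> and of \<open>1 - t\<close>.
\<close>

section \<open>The Bessel function K on the positive axis: convergence, decay, measurability\<close>

text \<open>The growth of \<open>cosh (lam * u)\<close> is at most \<open>exp (lam * u)\<close>,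
  while \<open>cosh u\<close> is at least \<open>u^2/4\<close>. The integrand is therefore below a
  Gaussian-type expression, and so below a constant times \<open>exp (- u)\<close>.\<close>

lemma set_integrable_exp_cosh_mult_cosh:
  fixes q lam :: real
  assumes "q > 0" and "lam \<ge> 0"
  shows "set_integrable lborel {0<..} (\<lambda>u. exp (- q * cosh u) * cosh (lam * u))"
proof -
  have "(\<lambda>u::real. exp (-1 * u)) absolutely_integrable_on {0..}"
    by (intro nonnegative_absolutely_integrable_1 integrable_on_exp_minus_to_infinity) auto
  hence "set_integrable lborel {0..} (\<lambda>u::real. exp (-1 * u))"
    unfolding set_integrable_def by (subst (asm) integrable_completion) auto
  hence int: "set_integrable lborel {0<..} (\<lambda>u::real. exp (-1 * u))"
    by (rule set_integrable_subset) auto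
  show ?thesis
  proof (rule set_integrable_bound[OF set_integrable_mult_right[OF int]])
    show "set_borel_measurable lborel {0<..} (\<lambda>u. exp (- q * cosh u) * cosh (lam * u))"
    proof -
      have [measurable]: "(\<lambda>u. exp (- q * cosh u) * cosh (lam * u)) \<in> borel_measurable borel"
        by (intro borel_measurable_continuous_onI continuous_intros)
      show ?thesis
        unfolding set_borel_measurable_def by measurable
    qed
    show "AE u in lborel. u \<in> {0<..} \<longrightarrow> norm (exp (- q * cosh u) * cosh (lam * u)) \<le>
            norm (exp ((lam + 1)\<^sup>2 / q) * exp (-1 * u))"
    proof (intro AE_I2 impI)
      fix u :: real assume "u \<in> {0<..}"
      hence u: "u > 0" by simp
      have "u^2/4 \<le> exp u / 2"
        using exp_lower_Taylor_quadratic[of u] u by simp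
      also have "exp u / 2 \<le> cosh u" by (simp add: cosh_field_def)
      finally have c: "u\<^sup>2 / 4 \<le> cosh u" .
      have "cosh (lam * u) \<le> exp (lam * u)"
        using u assms(2) by (simp add: cosh_field_def)
      hence "exp (- q * cosh u) * cosh (lam * u) \<le> exp (- q * cosh u) * exp (lam * u)"
        by (intro mult_left_mono) auto
      also have "\<dots> = exp (lam * u - q * cosh u)" by (simp flip: exp_add)
      also have "\<dots> \<le> exp ((lam + 1)\<^sup>2 / q - 1 * u)"
      proof -
        \<comment> \<open>Completing the square gives the constant \<open>(lam + 1)^2 / q\<close>.
          The extra 1 added to \<open>lam\<close> pays for the factor \<open>exp (- u)\<close> that
          the majorant keeps.\<close>
        have "0 \<le> ((lam + 1) - q * u / 2)\<^sup>2 / q" using assms by simp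
        also have "\<dots> = (lam+1)\<^sup>2 / q - (lam + 1) * u + q * (u\<^sup>2 / 4)"
          using assms by (simp add: field_simps power2_eq_square)
        also have "\<dots> \<le> (lam+1)\<^sup>2 / q - (lam + 1) * u + q * cosh u"
          using c assms by simp
        finally show ?thesis by (simp add: algebra_simps)
      qed
      finally show "norm (exp (- q * cosh u) * cosh (lam * u)) \<le>
            norm (exp ((lam + 1)\<^sup>2 / q) * exp (-1 * u))"
        by (simp add: abs_mult exp_diff exp_minus field_simps)
    qed
  qed
qed

text \<open>The integral on the right is K at \<open>q\<close>, written over the reals: a constant
  in \<open>y\<close>, so that all dependence on \<open>y\<close> sits in the exponential.\<close>

lemma norm_bessel_K_le:
  fixes lam q y :: real
  assumes "lam \<ge> 0" and "q > 0" and "q \<le> y"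
  shows "norm (bessel_K (of_real lam) (of_real y)) \<le>
    exp (q - y) * (LINT u:{0<..}|lborel. exp (- q * cosh u) * cosh (lam * u))"
proof -
  have eq: "exp (- complex_of_real y * of_real (cosh u)) * cosh (of_real lam * of_real u) =
      of_real (exp (- y * cosh u) * cosh (lam * u))" for u
    by (simp add: cosh_field_def flip: exp_of_real)
  have "norm (bessel_K (of_real lam) (of_real y)) \<le>
     (LINT u:{0<..}|lborel. exp (q - y) * (exp (- q * cosh u) * cosh (lam * u)))"
    unfolding bessel_K_def eq set_lebesgue_integral_def
  proof (rule Bochner_Integration.integral_norm_bound_integral)
    have *: "set_integrable lborel {0<..} (\<lambda>u. exp (- y * cosh u) * cosh (lam * u))"
      using assms by (intro set_integrable_exp_cosh_mult_cosh) auto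
    show "integrable lborel (\<lambda>u. indicat_real {0<..} u *\<^sub>R
        complex_of_real (exp (- y * cosh u) * cosh (lam * u)))"
      using integrable_of_real[OF *[unfolded set_integrable_def], where 'a = complex]
      by (simp add: scaleR_conv_of_real)
    show "integrable lborel (\<lambda>u. indicat_real {0<..} u *\<^sub>R
        (exp (q - y) * (exp (- q * cosh u) * cosh (lam * u))))"
      using set_integrable_mult_right[OF set_integrable_exp_cosh_mult_cosh[OF assms(2,1)]]
      unfolding set_integrable_def by blast
    fix u :: real
    \<comment> \<open>The factor \<open>q - y\<close> is at most 0, so \<open>cosh u \<ge> 1\<close>
      turns into an upper bound.\<close>
    have "(q - y) * cosh u \<le> (q - y) * 1"
      using assms cosh_real_ge_1[of u] by (intro mult_left_mono_neg) auto
    hence "exp (- y * cosh u) \<le> exp (q - y) * exp (- q * cosh u)"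
      by (simp flip: exp_add add: algebra_simps)
    hence "exp (- y * cosh u) * cosh (lam * u) \<le> exp (q - y) * exp (- q * cosh u) * cosh (lam * u)"
      by (intro mult_right_mono) auto
    thus "norm (indicat_real {0<..} u *\<^sub>R complex_of_real (exp (- y * cosh u) * cosh (lam * u)))
      \<le> indicat_real {0<..} u *\<^sub>R (exp (q - y) * (exp (- q * cosh u) * cosh (lam * u)))"
      by (simp add: indicator_def norm_mult abs_mult mult.assoc)
  qed
  also have "\<dots> = exp (q - y) * (LINT u:{0<..}|lborel. exp (- q * cosh u) * cosh (lam * u))"
    by simp
  finally show ?thesis .
qed

text \<open>A parameter integral is measurable in its parameter once the integrand is jointly
  measurable in \<open>y\<close> and \<open>u\<close>. Non-positive \<open>y\<close> is included,
  whatever value the integral takes there.\<close>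

lemma borel_measurable_bessel_K [measurable]:
  "(\<lambda>y::real. bessel_K lam (of_real y)) \<in> borel_measurable borel"
proof -
  have [measurable]: "(\<lambda>u::real. cosh (lam * of_real u)) \<in> borel_measurable borel"
    "(\<lambda>u::real. complex_of_real (cosh u)) \<in> borel_measurable borel"
    by (intro borel_measurable_continuous_onI continuous_intros; simp)+
  have [measurable]: "(exp :: complex \<Rightarrow> complex) \<in> borel_measurable borel"
    by (intro borel_measurable_continuous_onI continuous_intros)
  show ?thesis
    unfolding bessel_K_def set_lebesgue_integral_def
    by (rule lborel.borel_measurable_lebesgue_integral) measurable
qed

section \<open>The kernel of the extended Beta integral and its decay at both endpoints\<close>

lemma power_div_fact_le_exp:
  fixes x :: real
  assumes "x \<ge> 0"
  shows "x ^ n / fact n \<le> exp x"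
proof -
  have s: "(\<lambda>k. x ^ k / fact k) sums exp x"
    using exp_converges[of x] by (simp add: field_simps)
  thus ?thesis
    using sum_le_suminf[OF sums_summable[OF s], of "{n}"] assms by (simp add: sums_iff)
qed

text \<open>Near 0 a negative power of \<open>t\<close> is beaten by a single term of the series of
  \<open>exp (q / t)\<close>.\<close>

lemma powr_mult_exp_bounded:
  fixes q a :: real
  assumes "q > 0"
  obtains C where "C \<ge> 0" and "\<And>t. t \<in> {0<..<1} \<Longrightarrow> t powr a * exp (- q / t) \<le> C"
proof
  \<comment> \<open>The least natural number with \<open>- n \<le> a\<close>; it is 0 when
    \<open>a \<ge> 0\<close>. On the unit interval \<open>t powr a\<close> is then at most
    \<open>t powr (- n)\<close>.\<close>
  define n where "n = nat \<lceil>- a\<rceil>"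
  show "fact n / q ^ n \<ge> (0::real)" using assms by simp
  fix t :: real assume t: "t \<in> {0<..<1}"
  have "t powr a \<le> t powr (- real n)"
    using t by (intro powr_mono') (auto simp: n_def, linarith)
  also have "\<dots> = fact n / q ^ n * ((q / t) ^ n / fact n)"
    using t assms by (simp add: powr_minus powr_realpow field_simps)
  also have "\<dots> \<le> fact n / q ^ n * exp (q / t)"
    using t assms power_div_fact_le_exp[of "q/t" n] by (intro mult_left_mono) auto
  finally show "t powr a * exp (- q / t) \<le> fact n / q ^ n"
    by (simp add: exp_minus field_simps)
qed

text \<open>The integrand of \<open>ext_Beta\<close> for real \<open>p\<close>, with the square root
  left outside. Both series and both integral representations share it.\<close>

definition ext_kernel :: "real \<Rightarrow> real \<Rightarrow> complex \<Rightarrow> complex \<Rightarrow> real \<Rightarrow> complex" where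
  "ext_kernel p nu x y t =
     of_real t powr (x - 3/2) * of_real (1 - t) powr (y - 3/2) *
     bessel_K (of_real (nu + 1/2)) (of_real p / of_real (t * (1 - t)))"

lemma set_borel_measurable_ext_kernel:
  "set_borel_measurable borel {0<..<1} (ext_kernel p nu x y)"
proof -
  have [measurable]:
    "(\<lambda>t. indicator {0<..<1} t *\<^sub>R
        (complex_of_real t powr (x - 3/2) * of_real (1 - t) powr (y - 3/2))) \<in> borel_measurable borel"
  proof (rule borel_measurable_continuous_on_indicator)
    \<comment> \<open>Principal powers are continuous off the non-positive reals; on the open
      interval both bases are positive.\<close>
    show "continuous_on {0<..<1}
        (\<lambda>t. complex_of_real t powr (x - 3/2) * of_real (1 - t) powr (y - 3/2))"
      by (rule continuous_on_mult; rule continuous_on_powr_complex)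
         (auto simp: complex_nonpos_Reals_iff intro!: continuous_intros)
  qed simp
  have "(\<lambda>t. (indicator {0<..<1} t *\<^sub>R
        (complex_of_real t powr (x - 3/2) * of_real (1 - t) powr (y - 3/2))) *
         bessel_K (of_real (nu + 1/2)) (of_real (p / (t * (1 - t))))) \<in> borel_measurable borel"
    by measurable
  thus ?thesis
    by (simp add: set_borel_measurable_def ext_kernel_def)
qed

text \<open>The weight \<open>(1 - t) powr r\<close> with arbitrary real \<open>r\<close> is carried
  along because the integration over \<open>x\<close> produces a negative power of
  \<open>1 - chi * t\<close>, which for \<open>chi = 1\<close> is singular at the endpoint.\<close>

lemma ext_kernel_mult_powr_bounded:
  assumes "p > 0" and "nu \<ge> 0"
  obtains C where "C \<ge> 0"
    and "\<And>t. t \<in> {0<..<1} \<Longrightarrow> norm (ext_kernel p nu x y t) * (1 - t) powr r \<le> C"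
proof -
  obtain C1 where C1: "C1 \<ge> 0"
    "\<And>t. t \<in> {0<..<1} \<Longrightarrow> t powr (Re x - 3/2) * exp (- p / t) \<le> C1"
    using powr_mult_exp_bounded[OF assms(1), of "Re x - 3/2"] by blast
  obtain C2 where C2: "C2 \<ge> 0"
    "\<And>t. t \<in> {0<..<1} \<Longrightarrow> t powr (Re y - 3/2 + r) * exp (- p / t) \<le> C2"
    using powr_mult_exp_bounded[OF assms(1), of "Re y - 3/2 + r"] by blast
  define D where
    "D = exp p * (LINT u:{0<..}|lborel. exp (- p * cosh u) * cosh ((nu + 1/2) * u))"
  have D: "D \<ge> 0"
    unfolding D_def set_lebesgue_integral_def
    by (intro mult_nonneg_nonneg Bochner_Integration.integral_nonneg) (auto simp: indicator_def)
  show ?thesis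
  proof
    show "C1 * C2 * D \<ge> 0" using C1 C2 D by simp
    fix t :: real assume t: "t \<in> {0<..<1}"
    define z where "z = p / (t * (1 - t))"
    have z: "z = p / t + p / (1 - t)"
      using t by (simp add: z_def field_simps)
    \<comment> \<open>The Bessel argument \<open>z\<close> is thus never below \<open>p\<close>,
      which makes \<open>q = p\<close> admissible in \<open>norm_bessel_K_le\<close>.\<close>
    have "t * (1 - t) \<le> 1 * 1" using t by (intro mult_mono) auto
    hence "p * (t * (1 - t)) \<le> p" using assms by (simp add: mult_left_le)
    hence "p \<le> z" using t by (simp add: z_def pos_le_divide_eq)
    hence "norm (bessel_K (of_real (nu + 1/2)) (of_real z)) \<le> exp (- z) * D"
      using norm_bessel_K_le[of "nu + 1/2" p z] assms by (simp add: D_def exp_diff exp_minus field_simps)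
    also have "exp (- z) = exp (- p / t) * exp (- p / (1 - t))"
      by (simp add: z flip: exp_add)
    finally have K: "norm (bessel_K (of_real (nu + 1/2)) (of_real z)) \<le>
      exp (- p / t) * exp (- p / (1 - t)) * D" .
    have "norm (ext_kernel p nu x y t) * (1 - t) powr r =
      t powr (Re x - 3/2) * (1 - t) powr (Re y - 3/2 + r) * norm (bessel_K (of_real (nu + 1/2)) (of_real z))"
      using t by (simp add: ext_kernel_def z_def norm_mult norm_powr_real_powr powr_add
        del: of_real_diff)
    also have "\<dots> \<le> t powr (Re x - 3/2) * (1 - t) powr (Re y - 3/2 + r) *
       (exp (- p / t) * exp (- p / (1 - t)) * D)"
      by (intro mult_left_mono K) auto
    also have "\<dots> = (t powr (Re x - 3/2) * exp (- p / t)) *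
         ((1 - t) powr (Re y - 3/2 + r) * exp (- p / (1 - t))) * D"
      by (simp add: mult_ac)
    \<comment> \<open>The two endpoints are now separated: the first bound is used at
      \<open>t\<close>, the second at \<open>1 - t\<close>.\<close>
    also have "\<dots> \<le> C1 * C2 * D"
      using t C1 C2(1) C2(2)[of "1 - t"] D by (intro mult_mono mult_nonneg_nonneg) auto
    finally show "norm (ext_kernel p nu x y t) * (1 - t) powr r \<le> C1 * C2 * D" .
  qed
qed

lemma set_integrable_ext_kernel_mult_powr:
  assumes "p > 0" and "nu \<ge> 0"
  shows "set_integrable lborel {0<..<1} (\<lambda>t. norm (ext_kernel p nu x y t) * (1 - t) powr r)"
proof -
  obtain C where C: "C \<ge> 0"
    "\<And>t. t \<in> {0<..<1} \<Longrightarrow> norm (ext_kernel p nu x y t) * (1 - t) powr r \<le> C"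
    using ext_kernel_mult_powr_bounded[OF assms] by blast
  have [measurable]: "(\<lambda>t. indicator {0<..<1} t *\<^sub>R ext_kernel p nu x y t) \<in> borel_measurable borel"
    using set_borel_measurable_ext_kernel unfolding set_borel_measurable_def .
  have "(\<lambda>t. norm (indicator {0<..<1} t *\<^sub>R ext_kernel p nu x y t) * (1 - t) powr r)
     \<in> borel_measurable lborel"
    by measurable
  hence "set_borel_measurable lborel {0<..<1} (\<lambda>t. norm (ext_kernel p nu x y t) * (1 - t) powr r)"
    by (simp add: set_borel_measurable_def abs_mult mult.assoc)
  moreover have "set_integrable lborel {0<..<1} (\<lambda>t::real. C)"
    by (simp add: set_integrable_def)
  moreover have "norm (norm (ext_kernel p nu x y t) * (1 - t) powr r) \<le> norm C"
    if "t \<in> {0<..<1}" for t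
    using C that by (simp add: abs_mult)
  ultimately show ?thesis
    using set_integrable_bound by blast
qed

lemma set_integrable_ext_kernel:
  assumes "p > 0" and "nu \<ge> 0"
  shows "set_integrable lborel {0<..<1} (ext_kernel p nu x y)"
\<comment> \<open>With \<open>r = 0\<close> the weight equals 1 on the open interval.\<close>
proof (rule set_integrable_bound[OF set_integrable_ext_kernel_mult_powr[OF assms, of x y 0]])
  show "set_borel_measurable lborel {0<..<1} (ext_kernel p nu x y)"
    using set_borel_measurable_ext_kernel by (simp add: set_borel_measurable_def)
qed auto

lemma ext_kernel_add_of_nat:
  assumes "t \<in> {0<..<1}"
  shows "ext_kernel p nu (x + of_nat n) y t = of_real t ^ n * ext_kernel p nu x y t"
proof -
  have "complex_of_real t powr (x + of_nat n - 3/2) = of_real t powr (x - 3/2) * of_real t ^ n"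
    using assms powr_add[of "complex_of_real t" "x - 3/2" "of_nat n"] by (simp add: algebra_simps)
  thus ?thesis by (simp add: ext_kernel_def)
qed

section \<open>Termwise integration of power series\<close>

text \<open>Since \<open>t ^ n \<le> 1\<close> on the interval, the n-th term is dominated by
  \<open>norm (a n * z ^ n)\<close> times the integrable \<open>norm (w t)\<close>. Absolute
  summability at \<open>z\<close> thus controls the pointwise sums and the sum of the integrals
  alike.\<close>

lemma sums_set_integral_power_series:
  fixes w :: "real \<Rightarrow> complex" and a :: "nat \<Rightarrow> complex" and z :: complex
  assumes w: "set_integrable lborel {0<..<1} w"
    and a: "summable (\<lambda>n. norm (a n * z ^ n))"
  shows "(\<lambda>n. a n * z ^ n * (LINT t:{0<..<1}|lborel. of_real t ^ n * w t)) sums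
    (LINT t:{0<..<1}|lborel. w t * (\<Sum>n. a n * (z * of_real t) ^ n))"
proof -
  define f where "f n t = indicator {0<..<1} t *\<^sub>R (a n * z ^ n * (of_real t ^ n * w t))" for n t
  have le: "norm (f n t) \<le> norm (a n * z ^ n) * norm (indicator {0<..<1} t *\<^sub>R w t)" for n t
    using mult_right_mono[OF power_le_one, of t "norm (w t)" n]
    by (auto simp: f_def indicator_def norm_mult norm_power intro!: mult_left_mono)
  have w': "integrable lborel (\<lambda>t. indicator {0<..<1} t *\<^sub>R w t)"
    using w by (simp add: set_integrable_def)
  hence [measurable]: "(\<lambda>t. indicator {0<..<1} t *\<^sub>R w t) \<in> borel_measurable borel"
    by auto
  have "(\<lambda>t. a n * z ^ n * (of_real t ^ n * (indicator {0<..<1} t *\<^sub>R w t)))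
      \<in> borel_measurable lborel" for n
    by measurable
  hence "f n \<in> borel_measurable lborel" for n
    unfolding f_def by simp
  hence int: "integrable lborel (f n)" for n
    using le by (intro Bochner_Integration.integrable_bound[OF
        integrable_mult_right[OF integrable_norm[OF w'], of "norm (a n * z ^ n)"]] AE_I2) auto
  have sm: "summable (\<lambda>n. norm (f n t))" for t
    by (rule summable_comparison_test[OF _ summable_mult2[OF a,
        of "norm (indicator {0<..<1} t *\<^sub>R w t)"]]) (use le in auto)
  have sm': "summable (\<lambda>n. \<integral>t. norm (f n t) \<partial>lborel)"
  proof (rule summable_comparison_test[OF _ summable_mult2[OF a,
        of "\<integral>t. norm (indicator {0<..<1} t *\<^sub>R w t) \<partial>lborel"]], intro exI allI impI)
    fix n
    have "(\<integral>t. norm (f n t) \<partial>lborel) \<le>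
       (\<integral>t. norm (a n * z ^ n) * norm (indicator {0<..<1} t *\<^sub>R w t) \<partial>lborel)"
      by (intro integral_mono integrable_norm int integrable_mult_right w' le)
    thus "norm (\<integral>t. norm (f n t) \<partial>lborel) \<le>
       norm (a n * z ^ n) * (\<integral>t. norm (indicator {0<..<1} t *\<^sub>R w t) \<partial>lborel)"
      by simp
  qed
  have "(\<lambda>n. integral\<^sup>L lborel (f n)) sums (\<integral>t. (\<Sum>n. f n t) \<partial>lborel)"
    by (rule sums_integral[OF int _ sm']) (use sm in auto)
  moreover have "integral\<^sup>L lborel (f n) =
      a n * z ^ n * (LINT t:{0<..<1}|lborel. of_real t ^ n * w t)" for n
    unfolding f_def set_lebesgue_integral_def
    by (subst integral_mult_right_zero[symmetric]) simp
  moreover have "(\<Sum>n. f n t) =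
     indicator {0<..<1} t *\<^sub>R (w t * (\<Sum>n. a n * (z * of_real t) ^ n))" for t
  proof (cases "t \<in> {0<..<1}")
    case True
    have sm: "summable (\<lambda>n. a n * (z * of_real t) ^ n)"
    proof (rule summable_comparison_test[OF _ a], intro exI allI impI)
      show "norm (a n * (z * of_real t) ^ n) \<le> norm (a n * z ^ n)" for n
        using True by (auto simp: norm_mult norm_power power_mult_distrib
            intro!: mult_left_mono mult_right_le_one_le power_le_one)
    qed
    have "(\<Sum>n. f n t) = (\<Sum>n. w t * (a n * (z * of_real t) ^ n))"
      using True by (simp add: f_def power_mult_distrib mult_ac)
    also have "\<dots> = w t * (\<Sum>n. a n * (z * of_real t) ^ n)"
      by (rule suminf_mult[OF sm])
    finally show ?thesis using True by simp
  qed (auto simp: f_def)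
  ultimately show ?thesis
    by (simp add: set_lebesgue_integral_def)
qed

section \<open>Gamma integrals with a rate parameter\<close>

text \<open>The known integral lives on the completed measure; Borel measurability of the integrand
  moves it to \<open>lborel\<close>. The rate \<open>a\<close> then enters by the substitution of
  \<open>a * x\<close> for \<open>x\<close>.\<close>

lemma Gamma_integral_complex_scaled:
  assumes s: "Re s > 0" and a: "a > 0"
  shows "set_integrable lborel {0<..} (\<lambda>x. of_real x powr (s - 1) * of_real (exp (- a * x)))"
    and "(LINT x:{0<..}|lborel. of_real x powr (s - 1) * of_real (exp (- a * x))) =
      Gamma s * of_real a powr (- s)"
proof -
  define f where "f x = indicator {0<..} x *\<^sub>R
      (complex_of_real x powr (s - 1) * of_real (exp (- x)))" for x :: real
  have meas: "f \<in> borel_measurable borel"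
    unfolding f_def
  proof (rule borel_measurable_continuous_on_indicator)
    show "continuous_on {0<..} (\<lambda>x. complex_of_real x powr (s - 1) * of_real (exp (- x)))"
      by (rule continuous_on_mult, rule continuous_on_powr_complex)
         (auto intro!: continuous_intros)
  qed simp
  have abs: "(\<lambda>x. complex_of_real x powr (s - 1) * of_real (exp (- x))) absolutely_integrable_on {0<..}"
    using absolutely_integrable_Gamma_integral'[OF s] by (simp add: exp_minus divide_inverse)
  have int: "integrable lborel f"
    using abs meas integrable_completion[of f lborel] by (simp add: set_integrable_def f_def[abs_def])
  have val: "integral\<^sup>L lborel f = Gamma s"
  proof -
    have "integral\<^sup>L lborel f =
      (LINT x:{0<..}|lebesgue. complex_of_real x powr (s - 1) * of_real (exp (- x)))"
      using meas integral_completion[of f lborel] by (simp add: set_lebesgue_integral_def f_def[abs_def])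
    also have "\<dots> = integral {0<..} (\<lambda>x. complex_of_real x powr (s - 1) * of_real (exp (- x)))"
      by (rule set_lebesgue_integral_eq_integral(2)[OF abs])
    also have "\<dots> = Gamma s"
      using Gamma_integral_complex'[OF s]
      by (intro integral_unique) (simp add: exp_minus divide_inverse)
    finally show ?thesis .
  qed
  have scale: "f (0 + a * x) = of_real a powr (s - 1) * (indicator {0<..} x *\<^sub>R
      (complex_of_real x powr (s - 1) * of_real (exp (- a * x))))" for x
    using a by (auto simp: f_def indicator_def powr_times_real zero_less_mult_iff)
  have nz: "complex_of_real a powr (s - 1) \<noteq> 0" using a by simp
  have "integrable lborel (\<lambda>x. inverse (of_real a powr (s - 1)) * f (0 + a * x))"
    by (intro integrable_mult_right lborel_integrable_real_affine[OF int]) (use a in simp)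
  thus "set_integrable lborel {0<..} (\<lambda>x. of_real x powr (s - 1) * of_real (exp (- a * x)))"
    unfolding scale set_integrable_def mult.assoc[symmetric] left_inverse[OF nz] by simp
  have "Gamma s = a *\<^sub>R integral\<^sup>L lborel (\<lambda>x. f (0 + a * x))"
    using lborel_integral_real_affine[of a f 0] a by (simp only: val abs_of_pos)
  also have "integral\<^sup>L lborel (\<lambda>x. f (0 + a * x)) = of_real a powr (s - 1) *
      (LINT x:{0<..}|lborel. of_real x powr (s - 1) * of_real (exp (- a * x)))"
    unfolding scale set_lebesgue_integral_def by (rule integral_mult_right_zero)
  \<comment> \<open>The Jacobian \<open>a\<close> raises the exponent \<open>s - 1\<close> to
    \<open>s\<close>.\<close>
  also have "a *\<^sub>R (of_real a powr (s - 1) *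
      (LINT x:{0<..}|lborel. of_real x powr (s - 1) * of_real (exp (- a * x)))) =
      of_real a powr s * (LINT x:{0<..}|lborel. of_real x powr (s - 1) * of_real (exp (- a * x)))"
    using a by (simp add: powr_diff scaleR_conv_of_real)
  finally show "(LINT x:{0<..}|lborel. of_real x powr (s - 1) * of_real (exp (- a * x))) =
      Gamma s * of_real a powr (- s)"
    using a by (simp add: powr_minus field_simps)
qed

section \<open>Euler-type integrals for the extended confluent and Gauss functions\<close>

lemma ext_Beta_add_of_nat:
  "ext_Beta (of_real p) nu (x + of_nat n) y = csqrt (2 * of_real p / of_real pi) *
     (LINT t:{0<..<1}|lborel. of_real t ^ n * ext_kernel p nu x y t)"
proof -
  have "ext_Beta (of_real p) nu (x + of_nat n) y = csqrt (2 * of_real p / of_real pi) *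
     (LINT t:{0<..<1}|lborel. ext_kernel p nu (x + of_nat n) y t)"
    by (simp add: ext_Beta_def ext_kernel_def)
  also have "(LINT t:{0<..<1}|lborel. ext_kernel p nu (x + of_nat n) y t) =
      (LINT t:{0<..<1}|lborel. of_real t ^ n * ext_kernel p nu x y t)"
    by (rule set_lebesgue_integral_cong) (simp_all add: ext_kernel_add_of_nat)
  finally show ?thesis .
qed

text \<open>Common source of both representations: coefficients \<open>1 / fact n\<close> give
  \<open>ext_Phi\<close>, and \<open>pochhammer a n / fact n\<close> gives \<open>ext_F\<close>
  inside the unit disc.\<close>

lemma ext_Beta_power_series:
  fixes a :: "nat \<Rightarrow> complex"
  assumes "p > 0" and "nu \<ge> 0" and "summable (\<lambda>n. norm (a n * z ^ n))"
  shows "(\<Sum>n. a n * z ^ n * ext_Beta (of_real p) nu (b + of_nat n) (c - b) / Beta b (c - b)) =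
    1 / Beta b (c - b) * csqrt (2 * of_real p / of_real pi) *
    (LINT t:{0<..<1}|lborel. ext_kernel p nu b (c - b) t * (\<Sum>n. a n * (z * of_real t) ^ n))"
  using sums_mult[OF sums_set_integral_power_series[OF set_integrable_ext_kernel[OF assms(1,2)] assms(3)],
      of "1 / Beta b (c - b) * csqrt (2 * of_real p / of_real pi)" b "c - b"]
  by (simp add: ext_Beta_add_of_nat sums_iff mult_ac)

lemma ext_Phi_eq_integral:
  assumes "p > 0" and "nu \<ge> 0"
  shows "ext_Phi (of_real p) nu b c z =
    1 / Beta b (c - b) * csqrt (2 * of_real p / of_real pi) *
    (LINT t:{0<..<1}|lborel. ext_kernel p nu b (c - b) t * exp (z * of_real t))"
proof -
  have e: "inverse (fact n) * w ^ n = w ^ n /\<^sub>R fact n" for w :: complex and n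
    by (simp add: scaleR_conv_of_real)
  have "summable (\<lambda>n. norm (inverse (fact n) * z ^ n))"
    using summable_norm_exp[of z] by (simp only: e)
  from ext_Beta_power_series[OF assms this, of b c] show ?thesis
    unfolding e exp_def by (simp add: ext_Phi_def scaleR_conv_of_real field_simps)
qed

lemma ext_F_eq_integral:
  fixes chi :: real
  assumes "p > 0" and "nu \<ge> 0" and "chi \<ge> 0" and "chi \<le> 1"
  shows "ext_F (of_real p) nu a b c (of_real chi) =
    1 / Beta b (c - b) * csqrt (2 * of_real p / of_real pi) *
    (LINT t:{0<..<1}|lborel. ext_kernel p nu b (c - b) t * of_real (1 - chi * t) powr (- a))"
proof (cases "chi < 1")
  case True
  define d where "d n = pochhammer a n / fact n" for n
  \<comment> \<open>The signs of the generalized binomial coefficient and of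
    \<open>(- w) ^ n\<close> cancel, leaving the Pochhammer form.\<close>
  have d: "(-a gchoose n) * (- w) ^ n = d n * w ^ n" for w n
    by (simp add: d_def gbinomial_pochhammer power_minus[of w])
  have sums: "(\<lambda>n. d n * w ^ n) sums (1 - w) powr (-a)" if "norm w < 1" for w
    using gen_binomial_complex[of "- w" "- a"] that by (simp add: d)
  \<comment> \<open>The midpoint of \<open>chi\<close> and 1 still lies inside the disc; convergence
    there gives absolute convergence at \<open>chi\<close>.\<close>
  have "norm (complex_of_real chi) < norm (complex_of_real ((1 + chi) / 2))"
    using True assms by (simp del: of_real_add of_real_divide)
  moreover have "norm (complex_of_real ((1 + chi) / 2)) < 1"
    using True assms by (simp del: of_real_add of_real_divide)
  ultimately have "summable (\<lambda>n. norm (d n * of_real chi ^ n))"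
    using powser_insidea sums sums_summable by blast
  from ext_Beta_power_series[OF assms(1,2) this, of b c]
  have "ext_F (of_real p) nu a b c (of_real chi) =
    1 / Beta b (c - b) * csqrt (2 * of_real p / of_real pi) *
    (LINT t:{0<..<1}|lborel. ext_kernel p nu b (c - b) t * (\<Sum>n. d n * (of_real chi * of_real t) ^ n))"
    using True assms by (simp add: ext_F_def d_def mult_ac)
  also have "(LINT t:{0<..<1}|lborel. ext_kernel p nu b (c - b) t * (\<Sum>n. d n * (of_real chi * of_real t) ^ n))
     = (LINT t:{0<..<1}|lborel. ext_kernel p nu b (c - b) t * of_real (1 - chi * t) powr (- a))"
  proof (rule set_lebesgue_integral_cong)
    show "\<forall>t. t \<in> {0<..<1} \<longrightarrow>
      ext_kernel p nu b (c - b) t * (\<Sum>n. d n * (of_real chi * of_real t) ^ n) =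
      ext_kernel p nu b (c - b) t * of_real (1 - chi * t) powr (- a)"
    proof (intro allI impI)
      fix t :: real assume "t \<in> {0<..<1}"
      hence "norm (complex_of_real chi * of_real t) < 1"
        using True assms mult_left_le[of t chi] by (simp add: norm_mult)
      from sums[OF this] show "ext_kernel p nu b (c - b) t * (\<Sum>n. d n * (of_real chi * of_real t) ^ n) =
        ext_kernel p nu b (c - b) t * of_real (1 - chi * t) powr (- a)"
        by (simp add: sums_iff)
    qed
  qed simp
  finally show ?thesis .
next
  case False
  \<comment> \<open>Here \<open>ext_F\<close> is the integral by definition, as its norm test
    fails.\<close>
  hence "chi = 1" using assms by simp
  thus ?thesis by (simp add: ext_F_def ext_kernel_def mult_ac)
qed

section \<open>The double integral over t and x\<close>

text \<open>The real case evaluates the integral of the norm in the Fubini argument, where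
  \<open>s\<close> is replaced by \<open>Re s\<close>.\<close>

lemma Gamma_integral_real_scaled:
  fixes r a :: real
  assumes "r > 0" and "a > 0"
  shows "(LINT x:{0<..}|lborel. x powr (r - 1) * exp (- a * x)) = Gamma r * a powr (- r)"
proof -
  have "complex_of_real (LINT x:{0<..}|lborel. x powr (r - 1) * exp (- a * x)) =
      (LINT x:{0<..}|lborel. of_real x powr (of_real r - 1) * of_real (exp (- a * x)))"
    unfolding set_integral_complex_of_real[symmetric]
  proof (rule set_lebesgue_integral_cong)
    show "\<forall>x. x \<in> {0<..} \<longrightarrow> complex_of_real (x powr (r - 1) * exp (- a * x)) =
      of_real x powr (of_real r - 1) * of_real (exp (- a * x))"
      using powr_of_real[of _ "r - 1"] by simp
  qed simp
  also have "\<dots> = Gamma (of_real r) * of_real a powr (- of_real r)"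
    using Gamma_integral_complex_scaled(2)[of "of_real r" a] assms by simp
  also have "\<dots> = of_real (Gamma r * a powr (- r))"
    using assms powr_of_real[of a "- r"] by (simp add: Gamma_complex_of_real)
  finally show ?thesis
    by (simp only: of_real_eq_iff)
qed

text \<open>The two exponentials combine to decay in \<open>x\<close> at the rate
  \<open>k * (1 - chi * t)\<close>, positive for \<open>t < 1\<close>. Integrability and value both
  come from one application of Fubini to \<open>f\<close>.\<close>

lemma Mellin_transform_ext_kernel:
  fixes p nu k chi :: real and s b d :: complex
  assumes p: "p > 0" and nu: "nu \<ge> 0" and s: "Re s > 0" and k: "k > 0"
    and chi: "chi \<ge> 0" "chi \<le> 1"
  defines "g \<equiv> \<lambda>x. of_real x powr (s - 1) * of_real (exp (- k * x)) *
     (LINT t:{0<..<1}|lborel. ext_kernel p nu b d t * exp (of_real (k * chi * x) * of_real t))"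
  shows "set_integrable lborel {0<..} g"
    and "(LINT x:{0<..}|lborel. g x) = Gamma s * of_real k powr (- s) *
      (LINT t:{0<..<1}|lborel. ext_kernel p nu b d t * of_real (1 - chi * t) powr (- s))"
proof -
  \<comment> \<open>The indicators are built into \<open>W\<close> and \<open>X\<close>, making
    \<open>f\<close> a measurable function on the whole plane.\<close>
  define W where "W t = indicator {0<..<1} t *\<^sub>R ext_kernel p nu b d t" for t
  define X where "X x = indicator {0<..} x *\<^sub>R (complex_of_real x powr (s - 1))" for x :: real
  define f where
    "f = (\<lambda>(t, x). W t * (X x * of_real (exp (- (k * (1 - chi * t)) * x))))"
  have pos: "k * (1 - chi * t) > 0" if "t \<in> {0<..<1}" for t
  proof -
    have "chi * t \<le> t" using that chi by (intro mult_left_le_one_le) auto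
    also have "t < 1" using that by simp
    finally show ?thesis using k by simp
  qed
  have W [measurable]: "W \<in> borel_measurable borel"
    using set_borel_measurable_ext_kernel by (simp add: set_borel_measurable_def W_def[abs_def])
  have X [measurable]: "X \<in> borel_measurable borel"
    unfolding X_def
    by (intro borel_measurable_continuous_on_indicator continuous_on_powr_complex)
       (auto intro!: continuous_intros)
  have f [measurable]: "f \<in> borel_measurable (lborel \<Otimes>\<^sub>M lborel)"
    unfolding f_def by measurable
  have f_eq: "f (t, x) = W t * (indicator {0<..} x *\<^sub>R
      (complex_of_real x powr (s - 1) * of_real (exp (- (k * (1 - chi * t)) * x))))" for t x
    by (simp add: f_def X_def)
  have norm_f: "norm (f (t, x)) = norm (W t) * (indicator {0<..} x *\<^sub>R
      (x powr (Re s - 1) * exp (- (k * (1 - chi * t)) * x)))" for t x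
    by (auto simp: f_eq norm_mult norm_powr_real_powr indicator_def)
  have inner: "(\<integral>x. f (t, x) \<partial>lborel) = Gamma s * of_real k powr (- s) * (indicator {0<..<1} t *\<^sub>R
      (ext_kernel p nu b d t * of_real (1 - chi * t) powr (- s)))" for t
  proof (cases "t \<in> {0<..<1}")
    case True
    have "1 - chi * t \<ge> 0" using pos[OF True] k by (simp add: zero_less_mult_iff)
    hence scale: "complex_of_real (k * (1 - chi * t)) powr (- s) =
        of_real k powr (- s) * of_real (1 - chi * t) powr (- s)"
      unfolding of_real_mult using k by (intro powr_times_real) auto
    have "(\<integral>x. f (t, x) \<partial>lborel) = W t * (LINT x:{0<..}|lborel.
        of_real x powr (s - 1) * of_real (exp (- (k * (1 - chi * t)) * x)))"
      unfolding f_eq set_lebesgue_integral_def by (rule integral_mult_right_zero)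
    also have "\<dots> = W t * (Gamma s * (of_real k powr (- s) * of_real (1 - chi * t) powr (- s)))"
      by (simp only: Gamma_integral_complex_scaled(2)[OF s pos[OF True]] scale)
    finally show ?thesis using True by (simp add: W_def mult_ac)
  qed (simp add: f_eq W_def)
  have norm_inner: "(\<integral>x. norm (f (t, x)) \<partial>lborel) \<le>
      Gamma (Re s) * k powr (- Re s) * (indicator {0<..<1} t *\<^sub>R
        (norm (ext_kernel p nu b d t) * (1 - t) powr (- Re s)))" for t
  proof (cases "t \<in> {0<..<1}")
    case True
    have "(\<integral>x. norm (f (t, x)) \<partial>lborel) = norm (W t) * (LINT x:{0<..}|lborel.
        x powr (Re s - 1) * exp (- (k * (1 - chi * t)) * x))"
      unfolding norm_f set_lebesgue_integral_def by (rule integral_mult_right_zero)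
    also have "\<dots> = norm (W t) * (Gamma (Re s) * (k * (1 - chi * t)) powr (- Re s))"
      by (simp only: Gamma_integral_real_scaled[OF s pos[OF True]])
    \<comment> \<open>The exponent \<open>- Re s\<close> is negative and
      \<open>1 - t \<le> 1 - chi * t\<close>, so \<open>chi = 1\<close> is the worst case. The
      resulting majorant is the weighted kernel with \<open>r = - Re s\<close>.\<close>
    also have "\<dots> \<le> norm (W t) * (Gamma (Re s) * (k * (1 - t)) powr (- Re s))"
    proof (rule mult_left_mono[OF mult_left_mono[OF powr_mono2']])
      have "chi * t \<le> t" using True chi by (intro mult_left_le_one_le) auto
      thus "k * (1 - t) \<le> k * (1 - chi * t)" using k by (intro mult_left_mono) auto
    qed (use True k s Gamma_real_pos[OF s] in auto)
    also have "(k * (1 - t)) powr (- Re s) = k powr (- Re s) * (1 - t) powr (- Re s)"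
      by (rule powr_mult)
    finally show ?thesis using True by (simp add: W_def mult_ac)
  qed (simp add: f_eq W_def)
  have integrable_f: "integrable (lborel \<Otimes>\<^sub>M lborel) f"
  proof (rule lborel_pair.Fubini_integrable[OF f])
    show "integrable lborel (\<lambda>t. \<integral>x. norm (f (t, x)) \<partial>lborel)"
    proof (rule Bochner_Integration.integrable_bound[OF integrable_mult_right])
      show "integrable lborel (\<lambda>t. indicat_real {0<..<1} t *\<^sub>R
          (norm (ext_kernel p nu b d t) * (1 - t) powr (- Re s)))"
        using set_integrable_ext_kernel_mult_powr[OF p nu] unfolding set_integrable_def .
      show "(\<lambda>t. \<integral>x. norm (f (t, x)) \<partial>lborel) \<in> borel_measurable lborel"
        by measurable
      show "AE t in lborel. norm (\<integral>x. norm (f (t, x)) \<partial>lborel) \<le>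
        norm (Gamma (Re s) * k powr (- Re s) * (indicator {0<..<1} t *\<^sub>R
        (norm (ext_kernel p nu b d t) * (1 - t) powr (- Re s))))"
      proof (rule AE_I2)
        fix t
        have "0 \<le> (\<integral>x. norm (f (t, x)) \<partial>lborel)" by simp
        with norm_inner[of t] show "norm (\<integral>x. norm (f (t, x)) \<partial>lborel) \<le>
          norm (Gamma (Re s) * k powr (- Re s) * (indicator {0<..<1} t *\<^sub>R
          (norm (ext_kernel p nu b d t) * (1 - t) powr (- Re s))))"
          unfolding real_norm_def by linarith
      qed
    qed
    show "AE t in lborel. integrable lborel (\<lambda>x. f (t, x))"
    proof (rule AE_I2)
      fix t
      show "integrable lborel (\<lambda>x. f (t, x))"
      proof (cases "t \<in> {0<..<1}")
        case True
        thus ?thesis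
          using Gamma_integral_complex_scaled(1)[OF s pos[OF True]]
          unfolding f_eq set_integrable_def by (intro integrable_mult_right)
      qed (simp add: f_eq W_def)
    qed
  qed
  have outer: "(\<integral>t. f (t, x) \<partial>lborel) = indicator {0<..} x *\<^sub>R g x" for x
  proof -
    have "f (t, x) = (indicator {0<..} x *\<^sub>R (of_real x powr (s - 1) * of_real (exp (- k * x)))) *
       (indicator {0<..<1} t *\<^sub>R
         (ext_kernel p nu b d t * exp (of_real (k * chi * x) * of_real t)))" for t
    proof -
      \<comment> \<open>Splitting the rate again frees the factors depending on \<open>x\<close>
        alone, which leave the integral over \<open>t\<close>.\<close>
      have "exp (- (k * (1 - chi * t)) * x) = exp (- k * x) * exp (k * chi * x * t)"
        by (simp add: algebra_simps flip: exp_add)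
      hence "complex_of_real (exp (- (k * (1 - chi * t)) * x)) =
          of_real (exp (- k * x)) * exp (of_real (k * chi * x) * of_real t)"
        by (simp only: of_real_mult flip: exp_of_real)
      thus ?thesis by (simp only: f_eq W_def) (simp add: indicator_def)
    qed
    thus ?thesis
      unfolding g_def set_lebesgue_integral_def
      by (simp only: integral_mult_right_zero) (simp only: mult_scaleR_left)
  qed
  have f': "integrable (lborel \<Otimes>\<^sub>M lborel) (\<lambda>(t, x). (\<lambda>t x. f (t, x)) t x)"
    using integrable_f by simp
  show "set_integrable lborel {0<..} g"
    using lborel_pair.integrable_snd[OF f'] by (simp add: outer set_integrable_def)
  show "(LINT x:{0<..}|lborel. g x) = Gamma s * of_real k powr (- s) *
      (LINT t:{0<..<1}|lborel. ext_kernel p nu b d t * of_real (1 - chi * t) powr (- s))"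
    using lborel_pair.Fubini_integral[OF f'] unfolding outer inner set_lebesgue_integral_def
    by (simp only: integral_mult_right_zero)
qed

section \<open>The integral of the extended Whittaker function\<close>

theorem theorem5:
  fixes p \<nu> \<alpha> \<beta> chi :: real and \<kappa> \<mu> :: complex
  assumes "p > 0" and "\<nu> \<ge> 0"
    and "\<alpha> > 0" and "\<beta> > 0" and "2 * \<alpha> - \<beta> \<ge> 0"
    and "chi = 2 * \<beta> / (2 * \<alpha> + \<beta>)"
    and "2 * \<mu> \<notin> {- of_nat n | n. n \<ge> 1}"
    and "\<mu> + \<kappa> + 1/2 \<notin> \<int>\<^sub>\<le>\<^sub>0" and "\<mu> - \<kappa> + 1/2 \<notin> \<int>\<^sub>\<le>\<^sub>0"
    and "Re (\<mu> + of_real \<alpha> + 1/2) > 0"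
  shows "0 < chi \<and> chi \<le> 1 \<and>
    set_integrable lborel {0<..} (\<lambda>x. of_real (x powr (\<alpha> - 1) * exp (- \<alpha> * x)) *
        ext_Whittaker_M (of_real p) \<nu> \<kappa> \<mu> (of_real (\<beta> * x))) \<and>
    (LINT x:{0<..}|lborel. of_real (x powr (\<alpha> - 1) * exp (- \<alpha> * x)) *
        ext_Whittaker_M (of_real p) \<nu> \<kappa> \<mu> (of_real (\<beta> * x))) =
      of_real (\<beta> powr (- \<alpha>)) * Gamma (\<mu> + of_real \<alpha> + 1/2) *
      of_real chi powr (\<mu> + of_real \<alpha> + 1/2) *
      ext_F (of_real p) \<nu> (\<mu> + of_real \<alpha> + 1/2) (\<mu> - \<kappa> + 1/2) (2 * \<mu> + 1) (of_real chi)"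
proof -
  define s where "s = \<mu> + of_real \<alpha> + 1/2"
  define b where "b = \<mu> - \<kappa> + 1/2"
  define c where "c = 2 * \<mu> + 1"
  \<comment> \<open>Total decay rate: \<open>\<alpha>\<close> from the weight and
    \<open>\<beta> / 2\<close> from the Whittaker function. The given \<open>chi\<close> is exactly
    \<open>\<beta> / k\<close>, and \<open>2 * \<alpha> \<ge> \<beta>\<close> is what makes it at
    most 1.\<close>
  define k where "k = \<alpha> + \<beta> / 2"
  define C where "C = 1 / Beta b (c - b) * csqrt (2 * of_real p / of_real pi)"
  define M where "M x = of_real (x powr (\<alpha> - 1) * exp (- \<alpha> * x)) *
        ext_Whittaker_M (of_real p) \<nu> \<kappa> \<mu> (of_real (\<beta> * x))" for x
  define g where "g x = complex_of_real x powr (s - 1) * of_real (exp (- k * x)) *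
     (LINT t:{0<..<1}|lborel.
       ext_kernel p \<nu> b (c - b) t * exp (of_real (k * chi * x) * of_real t))" for x
  define J where
    "J = (LINT t:{0<..<1}|lborel. ext_kernel p \<nu> b (c - b) t * of_real (1 - chi * t) powr (- s))"
  have chi: "0 < chi" "chi \<le> 1" and k: "k > 0" and k_chi: "k * chi = \<beta>"
    unfolding k_def assms(6) using assms(3-5) by (simp_all add: field_simps)
  have s: "Re s > 0" using assms by (simp add: s_def)
  have g: "set_integrable lborel {0<..} g"
      "(LINT x:{0<..}|lborel. g x) = Gamma s * of_real k powr (- s) * J"
    unfolding g_def J_def
    using Mellin_transform_ext_kernel[OF assms(1,2) s k less_imp_le[OF chi(1)] chi(2)] by blast+
  \<comment> \<open>The powers of \<open>x\<close> collect to
    \<open>\<alpha> - 1 + \<mu> + 1/2 = s - 1\<close>, so only a constant separates the integrand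
    from \<open>g\<close>.\<close>
  have M: "M x = (C * of_real \<beta> powr (\<mu> + 1/2)) * g x" if x: "x \<in> {0<..}" for x
  proof -
    have "complex_of_real (\<beta> * x) powr (\<mu> + 1/2) = of_real \<beta> powr (\<mu> + 1/2) * of_real x powr (\<mu> + 1/2)"
      unfolding of_real_mult using x assms by (intro powr_times_real) auto
    moreover have "complex_of_real (x powr (\<alpha> - 1)) * of_real x powr (\<mu> + 1/2) = of_real x powr (s - 1)"
    proof -
      have "s - 1 = of_real (\<alpha> - 1) + (\<mu> + 1/2)" by (simp add: s_def)
      thus ?thesis using x powr_of_real[of x "\<alpha> - 1"] by (simp only: powr_add) simp
    qed
    moreover have "complex_of_real (exp (- \<alpha> * x)) * exp (- of_real (\<beta> * x) / 2) = of_real (exp (- k * x))"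
      by (simp add: k_def algebra_simps flip: exp_of_real exp_add)
    ultimately show ?thesis
      unfolding M_def g_def ext_Whittaker_M_def ext_Phi_eq_integral[OF assms(1,2)] k_chi
      unfolding b_def[symmetric] c_def[symmetric] C_def[symmetric] of_real_mult
      by (smt (verit, ccfv_threshold) mult.assoc mult.commute)
  qed
  have "set_integrable lborel {0<..} M \<longleftrightarrow>
      set_integrable lborel {0<..} (\<lambda>x. (C * of_real \<beta> powr (\<mu> + 1/2)) * g x)"
    using M by (intro set_integrable_cong) auto
  hence int: "set_integrable lborel {0<..} M"
    using set_integrable_mult_right[OF g(1)] by blast
  have "(LINT x:{0<..}|lborel. M x) = (LINT x:{0<..}|lborel. (C * of_real \<beta> powr (\<mu> + 1/2)) * g x)"
    using M by (intro set_lebesgue_integral_cong) auto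
  also have "\<dots> = C * of_real \<beta> powr (\<mu> + 1/2) * (Gamma s * of_real k powr (- s) * J)"
    using g(2) by simp
  also have "\<dots> = (of_real \<beta> powr (\<mu> + 1/2) * of_real k powr (- s)) * Gamma s * (C * J)"
    by (simp add: mult_ac)
  \<comment> \<open>Substituting \<open>k = \<beta> / chi\<close> leaves \<open>\<beta>\<close> with
    the exponent \<open>\<mu> + 1/2 - s = - \<alpha>\<close>. Principal powers may be split because
    all bases are positive reals.\<close>
  also have "of_real \<beta> powr (\<mu> + 1/2) * of_real k powr (- s) =
      of_real (\<beta> powr (- \<alpha>)) * of_real chi powr s"
  proof -
    have "complex_of_real \<beta> powr (- s) = of_real k powr (- s) * of_real chi powr (- s)"
      unfolding k_chi[symmetric] of_real_mult using chi k by (intro powr_times_real) auto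
    hence "complex_of_real k powr (- s) = of_real \<beta> powr (- s) * of_real chi powr s"
      using chi k by (simp add: powr_minus field_simps)
    hence "of_real \<beta> powr (\<mu> + 1/2) * of_real k powr (- s) =
       complex_of_real \<beta> powr (\<mu> + 1/2 + - s) * of_real chi powr s"
      using assms(4) by (simp only: powr_add) simp
    also have "\<mu> + 1/2 + - s = of_real (- \<alpha>)" by (simp add: s_def)
    finally show ?thesis
      using powr_of_real[of \<beta> "- \<alpha>"] assms(4) by simp
  qed
  also have "C * J = ext_F (of_real p) \<nu> s b c (of_real chi)"
    unfolding C_def J_def using chi assms(1,2) by (subst ext_F_eq_integral) auto
  finally have "(LINT x:{0<..}|lborel. M x) = of_real (\<beta> powr (- \<alpha>)) * Gamma s *
      of_real chi powr s * ext_F (of_real p) \<nu> s b c (of_real chi)"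
    by (simp add: mult_ac)
  with int chi show ?thesis
    unfolding M_def s_def b_def c_def by blast
qed

end
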